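(* Let $S$ be a $\Gamma$-semigroup. The following conditions are equivalent: (1) $S$ is intra-regular; (2) for every fuzzy ideal $\mu$ of $S$ and every $a\in S$ there exists $\beta\in\Gamma$ such that $\mu(a)=\mu(a\beta a)$.
   Context: Let $S$ and $\Gamma$ be non-empty sets. $S$ is a $\Gamma$-semigroup if there is a map $S\times\Gamma\times S\to S$, written $(a,\alpha,b)\mapsto a\alpha b$, with $(x\beta y)\gamma z=x\beta(y\gamma z)$ for all $x,y,z\in S$, $\beta,\gamma\in\Gamma$. $S$ is intra-regular if for each $a\in S$ there exist $x,y\in S$ and $\alpha,\beta,\gamma\in\Gamma$ with $a=x\alpha a\beta a\gamma y$. A fuzzy subset of $S$ is a function $\mu:S\to[0,1]$; it is non-empty if it is not identically $0$. A fuzzy ideal of $S$ is a non-empty fuzzy subset $\mu$ with $\mu(x\gamma y)\ge\mu(y)$ and $\mu(x\gamma y)\ge\mu(x)$ for all $x,y\in S$, $\gamma\in\Gamma$. *)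

theory Defs
  imports Complex_Main "HOL-Library.FuncSet"
begin

text \<open>\<open>m x \<gamma> y\<close> stands for the product \<open>x\<gamma>y\<close>; it is only meaningful on the carriers \<open>S\<close> and \<open>G\<close>.\<close>

locale gamma_semigroup =
  fixes S :: "'s set" and G :: "'g set" and m :: "'s \<Rightarrow> 'g \<Rightarrow> 's \<Rightarrow> 's"
  assumes S_nonempty: "S \<noteq> {}"
    and G_nonempty: "G \<noteq> {}"
    and m_closed: "\<lbrakk>x \<in> S; \<gamma> \<in> G; y \<in> S\<rbrakk> \<Longrightarrow> m x \<gamma> y \<in> S"
    and m_assoc: "\<lbrakk>x \<in> S; y \<in> S; z \<in> S; \<beta> \<in> G; \<gamma> \<in> G\<rbrakk>
      \<Longrightarrow> m (m x \<beta> y) \<gamma> z = m x \<beta> (m y \<gamma> z)"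

definition intra_regular :: "'s set \<Rightarrow> 'g set \<Rightarrow> ('s \<Rightarrow> 'g \<Rightarrow> 's \<Rightarrow> 's) \<Rightarrow> bool" where
  "intra_regular S G m \<longleftrightarrow>
    (\<forall>a\<in>S. \<exists>x\<in>S. \<exists>y\<in>S. \<exists>\<alpha>\<in>G. \<exists>\<beta>\<in>G. \<exists>\<gamma>\<in>G. a = m (m (m x \<alpha> a) \<beta> a) \<gamma> y)"

text \<open>Values of \<open>\<mu>\<close> outside \<open>S\<close> are unconstrained and never used.\<close>

definition fuzzy_subset :: "'s set \<Rightarrow> ('s \<Rightarrow> real) \<Rightarrow> bool" where
  "fuzzy_subset S \<mu> \<longleftrightarrow> \<mu> \<in> S \<rightarrow> {0..1}"

definition fuzzy_nonempty :: "'s set \<Rightarrow> ('s \<Rightarrow> real) \<Rightarrow> bool" where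
  "fuzzy_nonempty S \<mu> \<longleftrightarrow> (\<exists>x\<in>S. \<mu> x \<noteq> 0)"

definition fuzzy_ideal ::
    "'s set \<Rightarrow> 'g set \<Rightarrow> ('s \<Rightarrow> 'g \<Rightarrow> 's \<Rightarrow> 's) \<Rightarrow> ('s \<Rightarrow> real) \<Rightarrow> bool" where
  "fuzzy_ideal S G m \<mu> \<longleftrightarrow> fuzzy_subset S \<mu> \<and> fuzzy_nonempty S \<mu> \<and>
    (\<forall>x\<in>S. \<forall>y\<in>S. \<forall>\<gamma>\<in>G. \<mu> (m x \<gamma> y) \<ge> \<mu> y \<and> \<mu> (m x \<gamma> y) \<ge> \<mu> x)"

end

theory Submission
  imports Defs "HOL-Library.Indicator_Function"
begin

text \<open>For (2) \<open>\<Longrightarrow>\<close> (1), let \<open>\<mu>\<close> be the indicator of the ideal \<open>S\<Gamma>a\<Gamma>a\<Gamma>S\<close>. Applying (2) first to \<open>a\<close> and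
  then to \<open>a\<beta>a\<close> gives \<open>\<mu>(a) = \<mu>((a\<beta>a)\<delta>(a\<beta>a))\<close>. Since \<open>a\<beta>(a\<delta>a)\<beta>a\<close> lies in this ideal, so does \<open>a\<close>.\<close>

definition square_ideal :: "'s set \<Rightarrow> 'g set \<Rightarrow> ('s \<Rightarrow> 'g \<Rightarrow> 's \<Rightarrow> 's) \<Rightarrow> 's \<Rightarrow> 's set" where
  "square_ideal S G m a =
    {m (m (m x \<alpha> a) \<beta> a) \<gamma> y | x y \<alpha> \<beta> \<gamma>. x \<in> S \<and> y \<in> S \<and> \<alpha> \<in> G \<and> \<beta> \<in> G \<and> \<gamma> \<in> G}"

lemma intra_regular_iff_mem_square_ideal:
  "intra_regular S G m \<longleftrightarrow> (\<forall>a\<in>S. a \<in> square_ideal S G m a)"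
  unfolding intra_regular_def square_ideal_def by blast

text \<open>If a factor lies in \<open>I\<close>, absorption gives the product the value 1;
  otherwise both factors have value 0 and the inequalities are trivial. A point of \<open>I\<close>
  in \<open>S\<close> keeps the indicator from vanishing on \<open>S\<close>.\<close>

lemma fuzzy_ideal_indicator:
  assumes "I \<inter> S \<noteq> {}"
    and "\<And>x y \<gamma>. \<lbrakk>x \<in> S; y \<in> S; \<gamma> \<in> G; x \<in> I \<or> y \<in> I\<rbrakk> \<Longrightarrow> m x \<gamma> y \<in> I"
  shows "fuzzy_ideal S G m (indicator I)"
  using assms
  by (auto simp: fuzzy_ideal_def fuzzy_subset_def fuzzy_nonempty_def indicator_def)

context gamma_semigroup
begin

text \<open>By associativity the new factor is absorbed into the left outer factor \<open>x\<close>;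
  the middle part is untouched.\<close>

lemma square_ideal_mult_left:
  assumes "a \<in> S" "s \<in> S" "\<delta> \<in> G" "z \<in> square_ideal S G m a"
  shows "m s \<delta> z \<in> square_ideal S G m a"
proof -
  obtain x y \<alpha> \<beta> \<gamma> where z: "z = m (m (m x \<alpha> a) \<beta> a) \<gamma> y"
    and mem: "x \<in> S" "y \<in> S" "\<alpha> \<in> G" "\<beta> \<in> G" "\<gamma> \<in> G"
    using assms(4) unfolding square_ideal_def by blast
  have "m s \<delta> z = m (m (m (m s \<delta> x) \<alpha> a) \<beta> a) \<gamma> y"
    using assms(1-3) mem by (simp add: z m_assoc m_closed)
  moreover have "m s \<delta> x \<in> S"
    using assms mem by (simp add: m_closed)
  ultimately show ?thesis
    unfolding square_ideal_def using mem by blast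
qed

text \<open>Dually, the new factor is absorbed into the right outer factor \<open>y\<close>.\<close>

lemma square_ideal_mult_right:
  assumes "a \<in> S" "s \<in> S" "\<delta> \<in> G" "z \<in> square_ideal S G m a"
  shows "m z \<delta> s \<in> square_ideal S G m a"
proof -
  obtain x y \<alpha> \<beta> \<gamma> where z: "z = m (m (m x \<alpha> a) \<beta> a) \<gamma> y"
    and mem: "x \<in> S" "y \<in> S" "\<alpha> \<in> G" "\<beta> \<in> G" "\<gamma> \<in> G"
    using assms(4) unfolding square_ideal_def by blast
  have "m z \<delta> s = m (m (m x \<alpha> a) \<beta> a) \<gamma> (m y \<delta> s)"
    using assms(1-3) mem by (simp add: z m_assoc m_closed)
  moreover have "m y \<delta> s \<in> S"
    using assms mem by (simp add: m_closed)
  ultimately show ?thesis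
    unfolding square_ideal_def using mem by blast
qed

text \<open>Among the four copies of \<open>a\<close>, the outer two play the roles of
  \<open>x\<close> and \<open>y\<close>, and the inner two, joined by \<open>\<delta>\<close>, form
  the required square.\<close>

lemma square_of_square_mem_square_ideal:
  assumes "a \<in> S" "\<beta> \<in> G" "\<delta> \<in> G"
  shows "m (m a \<beta> a) \<delta> (m a \<beta> a) \<in> square_ideal S G m a"
proof -
  have "m (m a \<beta> a) \<delta> (m a \<beta> a) = m (m (m a \<beta> a) \<delta> a) \<beta> a"
    using assms by (simp add: m_assoc m_closed)
  then show ?thesis
    unfolding square_ideal_def using assms by blast
qed

lemma fuzzy_ideal_indicator_square_ideal:
  assumes "a \<in> S"
  shows "fuzzy_ideal S G m (indicator (square_ideal S G m a))"
proof (rule fuzzy_ideal_indicator)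
  \<comment> \<open>Any \<open>\<gamma>\<close> in \<open>G\<close> yields the witness
    \<open>(a\<gamma>a)\<gamma>(a\<gamma>a)\<close>.\<close>
  obtain \<gamma> where "\<gamma> \<in> G"
    using G_nonempty by blast
  then show "square_ideal S G m a \<inter> S \<noteq> {}"
    using square_of_square_mem_square_ideal[OF assms, of \<gamma> \<gamma>] assms m_closed by blast
qed (use assms square_ideal_mult_left square_ideal_mult_right in blast)

text \<open>The \<open>\<beta>\<close> supplied by intra-regularity works: \<open>a\<close> is the
  two-sided multiple \<open>x\<alpha>(a\<beta>a)\<gamma>y\<close> of \<open>a\<beta>a\<close>, while
  \<open>a\<beta>a\<close> is a multiple of \<open>a\<close>. Since \<open>\<mu>\<close> never
  decreases under multiplication, both inequalities follow.\<close>

lemma fuzzy_ideal_eq_square: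
  assumes "intra_regular S G m" "fuzzy_ideal S G m \<mu>" "a \<in> S"
  shows "\<exists>\<beta>\<in>G. \<mu> a = \<mu> (m a \<beta> a)"
proof -
  have le: "\<mu> x \<le> \<mu> (m x \<gamma> y)" "\<mu> y \<le> \<mu> (m x \<gamma> y)"
    if "x \<in> S" "y \<in> S" "\<gamma> \<in> G" for x y \<gamma>
    using assms(2) that unfolding fuzzy_ideal_def by blast+
  obtain x y \<alpha> \<beta> \<gamma> where a: "a = m (m (m x \<alpha> a) \<beta> a) \<gamma> y"
    and mem: "x \<in> S" "y \<in> S" "\<alpha> \<in> G" "\<beta> \<in> G" "\<gamma> \<in> G"
    using assms(1,3) unfolding intra_regular_def by blast
  have "\<mu> (m a \<beta> a) \<le> \<mu> (m x \<alpha> (m a \<beta> a))"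
    using mem assms(3) by (intro le) (simp_all add: m_closed)
  also have "\<dots> \<le> \<mu> (m (m x \<alpha> (m a \<beta> a)) \<gamma> y)"
    using mem assms(3) by (intro le) (simp_all add: m_closed)
  also have "m (m x \<alpha> (m a \<beta> a)) \<gamma> y = a"
    using mem assms(3) a by (simp add: m_assoc)
  finally have "\<mu> (m a \<beta> a) \<le> \<mu> a" .
  then show ?thesis
    using le(1)[of a a \<beta>] mem assms(3) by force
qed

lemma intra_regular_if_fuzzy_ideals_eq_square:
  assumes "\<And>\<mu> a. \<lbrakk>fuzzy_ideal S G m \<mu>; a \<in> S\<rbrakk> \<Longrightarrow> \<exists>\<beta>\<in>G. \<mu> a = \<mu> (m a \<beta> a)"
  shows "intra_regular S G m"
  unfolding intra_regular_iff_mem_square_ideal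
proof
  fix a assume a: "a \<in> S"
  let ?\<mu> = "indicator (square_ideal S G m a) :: 's \<Rightarrow> real"
  note fuzzy = fuzzy_ideal_indicator_square_ideal[OF a]
  obtain \<beta> where \<beta>: "\<beta> \<in> G" "?\<mu> a = ?\<mu> (m a \<beta> a)"
    using assms[OF fuzzy a] by blast
  \<comment> \<open>At this point \<open>a\<beta>a\<close> is not known to lie in the ideal, so the
    hypothesis is used again, for the same indicator at \<open>a\<beta>a\<close>, to reach a product
    of four copies of \<open>a\<close>.\<close>
  obtain \<delta> where \<delta>: "\<delta> \<in> G" "?\<mu> (m a \<beta> a) = ?\<mu> (m (m a \<beta> a) \<delta> (m a \<beta> a))"
    using assms[OF fuzzy m_closed[OF a \<beta>(1) a]] by blast
  have "?\<mu> a = 1"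
    using \<beta> \<delta> square_of_square_mem_square_ideal[OF a] by simp
  then show "a \<in> square_ideal S G m a"
    by (simp add: indicator_eq_1_iff)
qed

end

theorem theorem4p17:
  fixes S :: "'s set" and G :: "'g set" and m :: "'s \<Rightarrow> 'g \<Rightarrow> 's \<Rightarrow> 's"
  assumes "gamma_semigroup S G m"
  shows "intra_regular S G m \<longleftrightarrow>
    (\<forall>\<mu>. fuzzy_ideal S G m \<mu> \<longrightarrow> (\<forall>a\<in>S. \<exists>\<beta>\<in>G. \<mu> a = \<mu> (m a \<beta> a)))"
proof -
  interpret gamma_semigroup S G m
    by (rule assms)
  show ?thesis
    using fuzzy_ideal_eq_square intra_regular_if_fuzzy_ideals_eq_square by blast
qed

end
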